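(* For an integer $n \geq 3$ let $$ \psi_n(\alpha) = \frac{1}{2^{n-2}\, \Gamma(\frac{n}{2})^2} \int_0^1 (1-t^2)^{\frac{n-2}{2}} \bigg[\int_0^\infty\!\int_0^\infty \exp\Big[-\frac{r^2 + r'^2 -2rr' t\alpha}{2}\Big] (r r')^{n-2} \,dr\, dr'\bigg] dt . $$ Then, for $-1 \leq \alpha < 1$, $$ \psi_n(\alpha) \sim (1-\alpha)^{-\frac{n-3}{2}} \ \ (n \geq 4), \qquad \psi_3(\alpha) \sim \log\frac{1}{1-\alpha}. $$
   Context: For two positive quantities, $Q_1 \sim Q_2$ means that the ratio $Q_1/Q_2$ is bounded away from zero and infinity by some constants depending on $n$ only.
   Formalization: For n = 3, log(1/(1-α)) is ≤ 0 on [-1,0] and the ratio blows up as α→0+, so the claim is proved as: for every α₀ in (0,1), ψ_3 ~ log(1/(1-α)) on [α₀,1) and ψ_3 ~ 1 on [-1,α₀], with constants depending on α₀. *)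

theory Defs
  imports "HOL-Analysis.Analysis"
begin

definition psi :: "nat \<Rightarrow> real \<Rightarrow> real" where
  "psi n \<alpha> =
     1 / (2 ^ (n - 2) * (Gamma (real n / 2))\<^sup>2) *
     (LINT t:{0..1}|lborel. (1 - t\<^sup>2) powr ((real n - 2) / 2) *
        (LINT r':{0..}|lborel. (LINT r:{0..}|lborel.
           exp (- ((r\<^sup>2 + r'\<^sup>2 - 2 * r * r' * t * \<alpha>) / 2)) * (r * r') ^ (n - 2))))"

(* Q1 ~ Q2 for two quantities depending on a parameter x ranging over A, the implied constants
   being uniform in x. The notion only makes sense for positive quantities, so positivity on A
   is part of the definition. It is unrelated to asymptotic equivalence along a filter. *)
definition comparable_on :: "'a set \<Rightarrow> ('a \<Rightarrow> real) \<Rightarrow> ('a \<Rightarrow> real) \<Rightarrow> bool" where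
  "comparable_on A Q1 Q2 \<longleftrightarrow>
     (\<forall>x\<in>A. 0 < Q1 x \<and> 0 < Q2 x) \<and>
     (\<exists>c C. 0 < c \<and> 0 < C \<and> (\<forall>x\<in>A. c \<le> Q1 x / Q2 x \<and> Q1 x / Q2 x \<le> C))"

end

theory Submission
  imports Defs "HOL-Probability.Distributions"
begin

text \<open>
  Write \<open>m = n - 2\<close>. The substitution \<open>r = r' u\<close> turns the exponent of the inner double integral,
  taken at \<open>s = t \<alpha>\<close>, into \<open>- r'\<^sup>2 (1 + u\<^sup>2 - 2 u s) / 2\<close>. Integrating over \<open>r'\<close> first is then a
  Gaussian moment, which leaves \<open>m! 2\<^sup>m\<close> times the one-dimensional integral of
  \<open>u\<^sup>m / (1 + u\<^sup>2 - 2 u s)\<^bsup>m+1\<^esup>\<close> over the slopes \<open>u \<ge> 0\<close> (\<open>quadrant_integral_slope_form\<close>).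
  Since \<open>1 + u\<^sup>2 - 2 u s = (1 - u)\<^sup>2 + 2 u (1 - s)\<close>, this integrand is of order \<open>(1 - s)\<^bsup>-(m+1)\<^esup>\<close> on a
  window of width \<open>(1 - s)\<^bsup>1/2\<^esup>\<close> next to \<open>u = 1\<close>, and decays like a Cauchy density away from it; so the
  double integral is comparable to \<open>(1 - s)\<^bsup>-(m+1/2)\<^esup>\<close> (\<open>gaussian_moment_bounds\<close>).

  With \<open>\<epsilon> = 1 - \<alpha>\<close>, uniformly in \<open>t \<in> [0,1]\<close>, the factor \<open>1 - t\<^sup>2\<close> is comparable to \<open>1 - t\<close> and
  \<open>1 - t \<alpha>\<close> to \<open>1 - t + \<epsilon>\<close>. Hence \<open>\<psi>\<^sub>n\<close> is comparable to the integral over \<open>[0,1]\<close> of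
  \<open>(1 - t)\<^bsup>m/2\<^esup> (1 - t + \<epsilon>)\<^bsup>-(m+1/2)\<^esup>\<close> (\<open>psi_comparable_edge_integral\<close>). The part where \<open>1 - t\<close> is of
  order \<open>\<epsilon>\<close> contributes \<open>\<epsilon>\<^bsup>-(m-1)/2\<^esup>\<close>. For \<open>m \<ge> 2\<close> this dominates. For \<open>m = 1\<close> the integrand behaves like
  \<open>1 / (1 - t)\<close> as long as \<open>1 - t \<ge> \<epsilon>\<close>, every dyadic scale of \<open>1 - t\<close> contributes equally, and a logarithm
  appears; it only describes the size of \<open>\<psi>\<^sub>3\<close> when \<open>\<alpha>\<close> stays away from the zero of \<open>ln (1 / (1 - \<alpha>))\<close>
  at \<open>0\<close>, and below a fixed \<open>\<alpha>\<^sub>0 < 1\<close> the function \<open>\<psi>\<^sub>3\<close> is comparable to a constant.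
\<close>

section \<open>Reduction of the Gaussian double integral to slopes\<close>

text \<open>The dilation \<open>x \<mapsto> (2 / q)\<^bsup>1/2\<^esup> x\<close> reduces this to the standard moment \<open>m! / 2\<close>.\<close>

lemma nn_integral_odd_gaussian_moment:
  fixes q :: real
  assumes "0 < q"
  shows "(\<integral>\<^sup>+x. ennreal (x ^ (2 * m + 1) * exp (- (x\<^sup>2 * q / 2))) * indicator {0..} x \<partial>lborel)
           = ennreal (fact m * 2 ^ m / q ^ (m + 1))"
proof -
  define c where "c = sqrt (2 / q)"
  have c: "c > 0" "c\<^sup>2 = 2 / q" using assms by (auto simp: c_def)
  have std: "(\<integral>\<^sup>+x. ennreal (indicator {0..} x *\<^sub>R (exp (- x\<^sup>2) * x ^ (2 * m + 1))) \<partial>lborel)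
               = ennreal (fact m / 2)"
    using gaussian_moment_odd_pos[of m]
    by (intro trans[OF nn_integral_eq_integral])
       (auto simp: has_bochner_integral_iff indicator_def)
  have "(\<integral>\<^sup>+x. ennreal (x ^ (2 * m + 1) * exp (- (x\<^sup>2 * q / 2))) * indicator {0..} x \<partial>lborel)
      = ennreal c * (\<integral>\<^sup>+x. ennreal ((0 + c * x) ^ (2 * m + 1) * exp (- ((0 + c * x)\<^sup>2 * q / 2)))
                              * indicator {0..} (0 + c * x) \<partial>lborel)"
    using c by (subst nn_integral_real_affine[where c = c and t = 0]) auto
  also have "(\<integral>\<^sup>+x. ennreal ((0 + c * x) ^ (2 * m + 1) * exp (- ((0 + c * x)\<^sup>2 * q / 2)))
                              * indicator {0..} (0 + c * x) \<partial>lborel)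
      = (\<integral>\<^sup>+x. ennreal (c ^ (2 * m + 1))
            * ennreal (indicator {0..} x *\<^sub>R (exp (- x\<^sup>2) * x ^ (2 * m + 1))) \<partial>lborel)"
  proof (rule nn_integral_cong)
    fix x :: real
    have "(c * x)\<^sup>2 * q / 2 = x\<^sup>2" using c assms by (simp add: power_mult_distrib)
    then show "ennreal ((0 + c * x) ^ (2 * m + 1) * exp (- ((0 + c * x)\<^sup>2 * q / 2)))
                 * indicator {0..} (0 + c * x)
             = ennreal (c ^ (2 * m + 1))
                 * ennreal (indicator {0..} x *\<^sub>R (exp (- x\<^sup>2) * x ^ (2 * m + 1)))"
      using c by (auto simp: indicator_def zero_le_mult_iff power_mult_distrib ennreal_mult' mult_ac
          simp flip: ennreal_mult')
  qed
  also have "\<dots> = ennreal (c ^ (2 * m + 1)) * ennreal (fact m / 2)"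
    unfolding std[symmetric] by (rule nn_integral_cmult) measurable
  also have "ennreal c * \<dots> = ennreal (c * c ^ (2 * m + 1) * (fact m / 2))"
    using c by (simp only: mult.assoc ennreal_mult' less_imp_le zero_le_power)
  also have "c * c ^ (2 * m + 1) = (2 / q) ^ (m + 1)"
    unfolding c(2)[symmetric] by (simp add: power_add power_mult power2_eq_square mult_ac power_mult_distrib)
  also have "(2 / q) ^ (m + 1) * (fact m / 2) = fact m * 2 ^ m / q ^ (m + 1)"
    by (simp add: power_divide)
  finally show ?thesis .
qed

text \<open>For \<open>u > 0\<close> the form strictly exceeds \<open>(1 - u)\<^sup>2\<close>, its value at \<open>s = 1\<close>.\<close>

lemma slope_form_pos:
  fixes s u :: real
  assumes "s < 1" "0 \<le> u"
  shows "0 < 1 + u\<^sup>2 - 2 * u * s"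
proof (cases "u = 0")
  case False
  then have "u * s < u" using assms by simp
  moreover have "0 \<le> (1 - u)\<^sup>2" by simp
  ultimately show ?thesis by (simp add: power2_eq_square algebra_simps)
qed simp

text \<open>
  Rescaling the inner variable by \<open>r'\<close> makes the exponent homogeneous of degree two in \<open>r'\<close>, with the
  slope \<open>u = r / r'\<close> as a parameter; Tonelli then lets the \<open>r'\<close>-integral be evaluated in closed form.
  Working with extended nonnegative values postpones the question of convergence to the bounds below.
\<close>

lemma quadrant_integral_slope_form:
  fixes s :: real
  assumes "s < 1"
  shows "(\<integral>\<^sup>+r'. \<integral>\<^sup>+r. ennreal (indicator {0..} r' * (indicator {0..} r *
             (exp (- ((r\<^sup>2 + r'\<^sup>2 - 2 * r * r' * s) / 2)) * (r * r') ^ m))) \<partial>lborel \<partial>lborel)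
       = ennreal (fact m * 2 ^ m) *
         (\<integral>\<^sup>+u. ennreal (u ^ m / (1 + u\<^sup>2 - 2 * u * s) ^ (m + 1)) * indicator {0..} u \<partial>lborel)"
proof -
  let ?q = "\<lambda>u. 1 + u\<^sup>2 - 2 * u * s"
  let ?h = "\<lambda>r' u. ennreal (u ^ m * indicator {0..} u) *
               (ennreal (r' ^ (2 * m + 1) * exp (- (r'\<^sup>2 * ?q u / 2))) * indicator {0..} r')"
  have "(\<integral>\<^sup>+r'. \<integral>\<^sup>+r. ennreal (indicator {0..} r' * (indicator {0..} r *
             (exp (- ((r\<^sup>2 + r'\<^sup>2 - 2 * r * r' * s) / 2)) * (r * r') ^ m))) \<partial>lborel \<partial>lborel)
      = (\<integral>\<^sup>+r'. \<integral>\<^sup>+u. ?h r' u \<partial>lborel \<partial>lborel)"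
  proof (rule nn_integral_cong_AE, use AE_lborel_singleton[of "0::real"] in eventually_elim)
    fix r' :: real assume r': "r' \<noteq> 0"
    let ?f = "\<lambda>r. ennreal (indicator {0..} r' * (indicator {0..} r *
                (exp (- ((r\<^sup>2 + r'\<^sup>2 - 2 * r * r' * s) / 2)) * (r * r') ^ m)))"
    show "(\<integral>\<^sup>+r. ?f r \<partial>lborel) = (\<integral>\<^sup>+u. ?h r' u \<partial>lborel)"
    proof (cases "r' > 0")
      case False
      with r' have "r' < 0" by simp
      then show ?thesis by simp
    next
      case True
      have "(\<integral>\<^sup>+r. ?f r \<partial>lborel) = ennreal r' * (\<integral>\<^sup>+u. ?f (0 + r' * u) \<partial>lborel)"
        using True by (subst nn_integral_real_affine[where c = r' and t = 0]) auto
      also have "\<dots> = (\<integral>\<^sup>+u. ennreal r' * ?f (0 + r' * u) \<partial>lborel)"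
        by (subst nn_integral_cmult) auto
      also have "\<dots> = (\<integral>\<^sup>+u. ?h r' u \<partial>lborel)"
      proof (rule nn_integral_cong)
        fix u :: real
        have e: "(r' * u)\<^sup>2 + r'\<^sup>2 - 2 * (r' * u) * r' * s = r'\<^sup>2 * ?q u"
          by (simp add: power2_eq_square algebra_simps)
        have p: "r' * (r' * u * r') ^ m = u ^ m * r' ^ (2 * m + 1)"
          by (simp add: power_mult_distrib power_mult power2_eq_square mult_ac)
        show "ennreal r' * ?f (0 + r' * u) = ?h r' u"
        proof (cases "u \<ge> 0")
          case u: True
          have "ennreal r' * ?f (0 + r' * u)
              = ennreal (r' * (r' * u * r') ^ m * exp (- (r'\<^sup>2 * ?q u / 2)))"
            using True u e by (simp add: ennreal_mult' mult_ac flip: ennreal_mult')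
          also have "\<dots> = ?h r' u"
            unfolding p using True u by (simp add: mult_ac flip: ennreal_mult')
          finally show ?thesis .
        next
          case False
          with True have "r' * u < 0" by (simp add: mult_less_0_iff)
          with False show ?thesis by simp
        qed
      qed
      finally show ?thesis .
    qed
  qed
  also have "\<dots> = (\<integral>\<^sup>+u. \<integral>\<^sup>+r'. ?h r' u \<partial>lborel \<partial>lborel)"
    by (rule lborel_pair.Fubini') measurable
  also have "\<dots> = (\<integral>\<^sup>+u. ennreal (fact m * 2 ^ m) *
                    (ennreal (u ^ m / ?q u ^ (m + 1)) * indicator {0..} u) \<partial>lborel)"
  proof (rule nn_integral_cong)
    fix u :: real
    show "(\<integral>\<^sup>+r'. ?h r' u \<partial>lborel)
        = ennreal (fact m * 2 ^ m) * (ennreal (u ^ m / ?q u ^ (m + 1)) * indicator {0..} u)"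
    proof (cases "u \<ge> 0")
      case True
      then have "(\<integral>\<^sup>+r'. ?h r' u \<partial>lborel)
          = ennreal (u ^ m) * ennreal (fact m * 2 ^ m / ?q u ^ (m + 1))"
        using nn_integral_odd_gaussian_moment[of "?q u" m] slope_form_pos[OF assms True]
        by (subst nn_integral_cmult) auto
      then show ?thesis
        using True slope_form_pos[OF assms True] by (simp add: mult_ac flip: ennreal_mult')
    qed simp
  qed
  also have "\<dots> = ennreal (fact m * 2 ^ m) *
       (\<integral>\<^sup>+u. ennreal (u ^ m / ?q u ^ (m + 1)) * indicator {0..} u \<partial>lborel)"
    by (subst nn_integral_cmult) auto
  finally show ?thesis .
qed

section \<open>Size of the slope integral\<close>

lemma nn_integral_cauchy_density_le:
  fixes a s :: real
  assumes "0 < a"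
  shows "(\<integral>\<^sup>+u. ennreal (1 / ((u - s)\<^sup>2 + a\<^sup>2)) * indicator {0..} u \<partial>lborel) \<le> ennreal (pi / a)"
proof -
  have "(\<integral>\<^sup>+u. ennreal (1 / ((u - s)\<^sup>2 + a\<^sup>2)) * indicator {0..} u \<partial>lborel)
      = ennreal (pi / 2 / a - arctan ((0 - s) / a) / a)"
  proof (rule nn_integral_FTC_atLeast)
    show "((\<lambda>u. arctan ((u - s) / a) / a) \<longlongrightarrow> pi / 2 / a) at_top"
    proof (rule tendsto_divide)
      have "filterlim (\<lambda>u. (u - s) / a) at_top at_top"
        using assms by real_asymp
      then show "((\<lambda>u. arctan ((u - s) / a)) \<longlongrightarrow> pi / 2) at_top"
        by (rule filterlim_compose[OF tendsto_arctan_at_top])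
    qed (use assms in auto)
    fix x :: real
    have "0 < (x - s)\<^sup>2 + a\<^sup>2" using assms by (intro add_nonneg_pos) auto
    then show "((\<lambda>u. arctan ((u - s) / a) / a) has_real_derivative 1 / ((x - s)\<^sup>2 + a\<^sup>2)) (at x)"
      using assms
      by (auto intro!: derivative_eq_intros simp: divide_simps) (simp_all add: power2_eq_square algebra_simps)
  qed auto
  also have "\<dots> \<le> ennreal (pi / a)"
    using assms arctan_lbound[of "(0 - s) / a"]
    unfolding diff_divide_distrib[symmetric] by (intro ennreal_leI divide_right_mono) auto
  finally show ?thesis .
qed

text \<open>
  With \<open>q = 1 + u\<^sup>2 - 2 u s\<close>, split the integrand as \<open>(u / q)\<^sup>m \<cdot> 1 / q\<close>. For \<open>s \<ge> 0\<close> the first factor is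
  at most \<open>(2 (1 - s))\<^bsup>-m\<^esup>\<close>, because \<open>q - 2 u (1 - s)\<close> is a square, and \<open>q = (u - s)\<^sup>2 + (1 - s\<^sup>2)\<close> makes the
  second a Cauchy density of width at least \<open>(1 - s)\<^bsup>1/2\<^esup>\<close>. That width degenerates at \<open>s = -1\<close>, so for \<open>s < 0\<close>
  the bound \<open>q \<ge> 1 + u\<^sup>2\<close> is used instead; there \<open>1 - s\<close> lies between \<open>1\<close> and \<open>2\<close> and a constant suffices.
\<close>

lemma slope_integral_upper:
  fixes s :: real
  assumes "-1 \<le> s" "s < 1"
  shows "(\<integral>\<^sup>+u. ennreal (u ^ m / (1 + u\<^sup>2 - 2 * u * s) ^ (m + 1)) * indicator {0..} u \<partial>lborel)
           \<le> ennreal (pi * 2 ^ (m + 1) * (1 - s) powr (- (real m + 1 / 2)))"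
proof -
  \<comment> \<open>The integrand is at most \<open>K / ((u - s')\<^sup>2 + a\<^sup>2)\<close>, in both regimes of \<open>s\<close>.\<close>
  define K a s' :: real where "K = (if s \<ge> 0 then (1 / (2 * (1 - s))) ^ m else 1)"
    and "a = (if s \<ge> 0 then sqrt (1 - s\<^sup>2) else 1)" and "s' = max 0 s"
  have sq: "s\<^sup>2 \<le> s" if "s \<ge> 0" using that assms
    by (simp add: power2_eq_square mult_left_le)
  have a: "0 < a" using assms sq unfolding a_def by auto
  have K: "0 \<le> K" using assms by (simp add: K_def)
  have "(\<integral>\<^sup>+u. ennreal (u ^ m / (1 + u\<^sup>2 - 2 * u * s) ^ (m + 1)) * indicator {0..} u \<partial>lborel)
     \<le> (\<integral>\<^sup>+u. ennreal K * (ennreal (1 / ((u - s')\<^sup>2 + a\<^sup>2)) * indicator {0..} u) \<partial>lborel)"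
  proof (rule nn_integral_mono)
    fix u :: real
    have "u ^ m / (1 + u\<^sup>2 - 2 * u * s) ^ (m + 1) \<le> K * (1 / ((u - s')\<^sup>2 + a\<^sup>2))" if u: "0 \<le> u"
    proof -
      let ?q = "1 + u\<^sup>2 - 2 * u * s"
      have q: "0 < ?q" using slope_form_pos assms u by blast
      have "u ^ m / ?q ^ (m + 1) = (u / ?q) ^ m * (1 / ?q)" by (simp add: power_divide)
      also have "\<dots> \<le> K * (1 / ((u - s')\<^sup>2 + a\<^sup>2))"
      proof (cases "s \<ge> 0")
        case True
        have "?q = (1 - u)\<^sup>2 + 2 * (1 - s) * u" by (simp add: power2_eq_square algebra_simps)
        then have "2 * (1 - s) * u \<le> ?q" by simp
        then have "u / ?q \<le> 1 / (2 * (1 - s))"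
          using q assms by (simp add: field_simps)
        then have "(u / ?q) ^ m * (1 / ?q) \<le> (1 / (2 * (1 - s))) ^ m * (1 / ?q)"
          using q u by (intro mult_right_mono power_mono) auto
        moreover have "?q = (u - s')\<^sup>2 + a\<^sup>2"
          using True sq assms by (simp add: s'_def a_def power2_eq_square algebra_simps)
        moreover have "K = (1 / (2 * (1 - s))) ^ m" using True by (simp add: K_def)
        ultimately show ?thesis by metis
      next
        case False
        then have "u * s \<le> 0" using u by (simp add: mult_nonneg_nonpos)
        then have q1: "1 + u\<^sup>2 \<le> ?q" by linarith
        have "0 \<le> (1 - u)\<^sup>2" by simp
        then have "2 * u \<le> 1 + u\<^sup>2" by (simp add: power2_eq_square algebra_simps)
        then have "u \<le> ?q" using q1 u by linarith
        then have "u / ?q \<le> 1" using q by simp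
        then have "(u / ?q) ^ m \<le> 1" using u q by (intro power_le_one) auto
        moreover have "1 / ?q \<le> 1 / (1 + u\<^sup>2)"
          using q1 by (intro divide_left_mono mult_pos_pos) (use q in \<open>auto intro: add_pos_nonneg\<close>)
        ultimately have "(u / ?q) ^ m * (1 / ?q) \<le> 1 * (1 / (1 + u\<^sup>2))"
          using q u by (intro mult_mono) auto
        then show ?thesis using False by (simp add: K_def s'_def a_def add.commute)
      qed
      finally show ?thesis .
    qed
    then show "ennreal (u ^ m / (1 + u\<^sup>2 - 2 * u * s) ^ (m + 1)) * indicator {0..} u
       \<le> ennreal K * (ennreal (1 / ((u - s')\<^sup>2 + a\<^sup>2)) * indicator {0..} u)"
      using K by (auto simp: indicator_def ennreal_leI simp flip: ennreal_mult')
  qed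
  also have "\<dots> = ennreal K * (\<integral>\<^sup>+u. ennreal (1 / ((u - s')\<^sup>2 + a\<^sup>2)) * indicator {0..} u \<partial>lborel)"
    by (subst nn_integral_cmult) auto
  also have "\<dots> \<le> ennreal K * ennreal (pi / a)"
    using nn_integral_cauchy_density_le[OF a] by (intro mult_left_mono) auto
  also have "\<dots> = ennreal (K * (pi / a))" using K by (simp only: ennreal_mult')
  also have "\<dots> \<le> ennreal (pi * 2 ^ (m + 1) * (1 - s) powr (- (real m + 1 / 2)))"
  proof (rule ennreal_leI, cases "s \<ge> 0")
    case True
    have a': "sqrt (1 - s) \<le> a" using True sq by (simp add: a_def)
    have "1 / (2 * (1 - s)) = 1 / 2 * (1 / (1 - s))" by simp
    then have "(1 / (2 * (1 - s))) ^ m = (1 / 2) ^ m * (1 / (1 - s)) ^ m"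
      by (simp only: power_mult_distrib)
    then have "K * (pi / a) = (1 / 2) ^ m * pi * ((1 / (1 - s)) ^ m * (1 / a))"
      using True by (simp add: K_def)
    also have "\<dots> \<le> 2 ^ (m + 1) * pi * ((1 / (1 - s)) ^ m * (1 / sqrt (1 - s)))"
    proof (intro mult_mono)
      have "(1 / 2 :: real) ^ m \<le> 1" by (intro power_le_one) auto
      also have "1 \<le> (2::real) ^ (m + 1)" by (rule one_le_power) simp
      finally show "(1 / 2 :: real) ^ m \<le> 2 ^ (m + 1)" .
      show "1 / a \<le> 1 / sqrt (1 - s)" using a a' assms by (intro divide_left_mono) auto
    qed (use a assms in auto)
    also have "(1 / (1 - s)) ^ m * (1 / sqrt (1 - s)) = (1 - s) powr (- (real m + 1 / 2))"
    proof -
      have "0 < 1 - s" using assms by simp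
      then have "(1 - s) powr (real m + 1 / 2) = (1 - s) ^ m * sqrt (1 - s)"
        by (simp only: powr_add powr_realpow powr_half_sqrt less_imp_le)
      then show ?thesis by (simp only: powr_minus) (simp add: power_divide field_simps)
    qed
    finally show "K * (pi / a) \<le> pi * 2 ^ (m + 1) * (1 - s) powr (- (real m + 1 / 2))"
      by (simp add: mult_ac)
  next
    case False
    have "(1 / 2) ^ (m + 1) = (2::real) powr (- real (m + 1))"
      by (simp only: powr_minus powr_realpow zero_less_numeral power_divide inverse_eq_divide power_one)
    also have "\<dots> \<le> 2 powr (- (real m + 1 / 2))" by simp
    also have "\<dots> \<le> (1 - s) powr (- (real m + 1 / 2))"
      using assms False by (intro powr_mono2') auto
    finally have "2 ^ (m + 1) * (1 / 2) ^ (m + 1) \<le> 2 ^ (m + 1) * (1 - s) powr (- (real m + 1 / 2))"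
      by (intro mult_left_mono) auto
    then have "1 \<le> 2 ^ (m + 1) * (1 - s) powr (- (real m + 1 / 2))"
      by (simp add: power_divide)
    then have "pi * 1 \<le> pi * (2 ^ (m + 1) * (1 - s) powr (- (real m + 1 / 2)))"
      by (intro mult_left_mono) auto
    then show "K * (pi / a) \<le> pi * 2 ^ (m + 1) * (1 - s) powr (- (real m + 1 / 2))"
      using False by (simp add: K_def a_def mult_ac)
  qed
  finally show ?thesis .
qed

text \<open>
  On the window \<open>1 \<le> u \<le> 1 + d\<^bsup>1/2\<^esup>\<close>, where \<open>d = 1 - s\<close>, both terms of \<open>(u - 1)\<^sup>2 + 2 u d\<close> are of order \<open>d\<close>.
  As \<open>d \<le> 2\<close>, also \<open>u \<le> 5/2\<close>, which gives the total bound \<open>6 d\<close>.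
\<close>

lemma slope_integral_lower:
  fixes s :: real
  assumes "-1 \<le> s" "s < 1"
  shows "ennreal ((1 / 6) ^ (m + 1) * (1 - s) powr (- (real m + 1 / 2)))
           \<le> (\<integral>\<^sup>+u. ennreal (u ^ m / (1 + u\<^sup>2 - 2 * u * s) ^ (m + 1)) * indicator {0..} u \<partial>lborel)"
proof -
  define d where "d = 1 - s"
  have d: "0 < d" "d \<le> 2" using assms by (auto simp: d_def)
  have "sqrt d \<le> sqrt ((3 / 2)\<^sup>2)" 
    using d by (intro real_sqrt_le_mono) (simp add: power2_eq_square)
  then have sd: "sqrt d \<le> 3 / 2" by simp
  have "ennreal ((1 / 6) ^ (m + 1) * d powr (- (real m + 1 / 2)))
      = ennreal ((1 / (6 * d)) ^ (m + 1)) * ennreal (sqrt d)"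
  proof -
    have "d powr (- (real m + 1 / 2)) = d powr (1 / 2 - real (m + 1))" by (simp add: algebra_simps)
    also have "\<dots> = sqrt d / d ^ (m + 1)"
      using d by (simp only: powr_diff powr_realpow powr_half_sqrt less_imp_le)
    finally show ?thesis using d
      by (simp add: power_mult_distrib power_divide flip: ennreal_mult')
  qed
  also have "\<dots> = (\<integral>\<^sup>+u. ennreal ((1 / (6 * d)) ^ (m + 1)) * indicator {1..1 + sqrt d} u \<partial>lborel)"
    using d by (simp add: nn_integral_cmult_indicator)
  also have "\<dots> \<le> (\<integral>\<^sup>+u. ennreal (u ^ m / (1 + u\<^sup>2 - 2 * u * s) ^ (m + 1)) * indicator {0..} u \<partial>lborel)"
  proof (rule nn_integral_mono)
    fix u :: real
    have "(1 / (6 * d)) ^ (m + 1) \<le> u ^ m / (1 + u\<^sup>2 - 2 * u * s) ^ (m + 1)"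
      if u: "1 \<le> u" "u \<le> 1 + sqrt d"
    proof -
      let ?q = "1 + u\<^sup>2 - 2 * u * s"
      have q: "0 < ?q" using slope_form_pos[of s u] assms u by auto
      have "(u - 1)\<^sup>2 \<le> (sqrt d)\<^sup>2" using u by (intro power_mono) auto
      moreover have "2 * u * d \<le> 5 * d" using u sd d by (intro mult_right_mono) auto
      moreover have "?q = (u - 1)\<^sup>2 + 2 * u * d" by (simp add: d_def power2_eq_square algebra_simps)
      moreover have "(sqrt d)\<^sup>2 = d" using d by simp
      ultimately have "?q \<le> 6 * d" by linarith
      then have "(1 / (6 * d)) ^ (m + 1) \<le> (1 / ?q) ^ (m + 1)"
        using q d by (intro power_mono divide_left_mono) auto
      also have "\<dots> = 1 / ?q ^ (m + 1)" by (simp add: power_divide)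
      also have "\<dots> \<le> u ^ m / ?q ^ (m + 1)"
        using q u by (intro divide_right_mono one_le_power) auto
      finally show ?thesis .
    qed
    then show "ennreal ((1 / (6 * d)) ^ (m + 1)) * indicator {1..1 + sqrt d} u
        \<le> ennreal (u ^ m / (1 + u\<^sup>2 - 2 * u * s) ^ (m + 1)) * indicator {0..} u"
      by (auto simp: indicator_def ennreal_leI)
  qed
  finally show ?thesis by (simp add: d_def)
qed


section \<open>Reduction to an integral concentrated near one endpoint\<close>

definition gaussian_moment :: "nat \<Rightarrow> real \<Rightarrow> real" where
  "gaussian_moment m s =
     (LINT r':{0..}|lborel. (LINT r:{0..}|lborel.
        exp (- ((r\<^sup>2 + r'\<^sup>2 - 2 * r * r' * s) / 2)) * (r * r') ^ m))"

lemma borel_measurable_gaussian_moment [measurable]: "gaussian_moment m \<in> borel_measurable borel"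
  unfolding gaussian_moment_def set_lebesgue_integral_def by measurable

text \<open>
  The upper bound on the slope integral makes the double integral finite, so that the iterated Bochner
  integral agrees with the extended one and is not a default value.
\<close>

lemma gaussian_moment_bounds:
  assumes "-1 \<le> s" "s < 1"
  shows "fact m * 2 ^ m * (1 / 6) ^ (m + 1) * (1 - s) powr (- (real m + 1 / 2)) \<le> gaussian_moment m s"
    and "gaussian_moment m s \<le> fact m * 2 ^ m * (pi * 2 ^ (m + 1)) * (1 - s) powr (- (real m + 1 / 2))"
proof -
  let ?F = "\<lambda>r' r. indicator {0..} r' * (indicator {0..} r *
              (exp (- ((r\<^sup>2 + r'\<^sup>2 - 2 * r * r' * s) / 2)) * (r * r') ^ m)) :: real"
  let ?R = "\<integral>\<^sup>+u. ennreal (u ^ m / (1 + u\<^sup>2 - 2 * u * s) ^ (m + 1)) * indicator {0..} u \<partial>lborel"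
  have nonneg: "0 \<le> ?F r' r" for r' r by (auto simp: indicator_def)
  obtain x where x: "0 \<le> x" "?R = ennreal x"
    using slope_integral_upper[OF assms, of m] by (cases ?R) (auto simp: top_unique)
  have N: "(\<integral>\<^sup>+p. ennreal (case p of (r', r) \<Rightarrow> ?F r' r) \<partial>(lborel \<Otimes>\<^sub>M lborel)) = ennreal (fact m * 2 ^ m * x)"
    using quadrant_integral_slope_form[OF assms(2), of m] x
    by (subst lborel.nn_integral_fst[symmetric]) (auto simp: ennreal_mult')
  have int: "integrable (lborel \<Otimes>\<^sub>M lborel) (\<lambda>(r', r). ?F r' r)"
    using N nonneg by (intro integrableI_nonneg) (auto simp: split_beta)
  have "gaussian_moment m s = (\<integral>r'. \<integral>r. ?F r' r \<partial>lborel \<partial>lborel)"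
    by (simp add: gaussian_moment_def set_lebesgue_integral_def)
  also have "\<dots> = integral\<^sup>L (lborel \<Otimes>\<^sub>M lborel) (\<lambda>(r', r). ?F r' r)"
    by (rule lborel_pair.integral_fst[OF int])
  also have "\<dots> = fact m * 2 ^ m * x"
    using N x nonneg by (subst integral_eq_nn_integral) (auto simp: split_beta)
  finally have eq: "gaussian_moment m s = fact m * 2 ^ m * x" .
  have "(1 / 6) ^ (m + 1) * (1 - s) powr (- (real m + 1 / 2)) \<le> x"
    using slope_integral_lower[OF assms, of m] x by (simp del: power_Suc)
  then show "fact m * 2 ^ m * (1 / 6) ^ (m + 1) * (1 - s) powr (- (real m + 1 / 2)) \<le> gaussian_moment m s"
    unfolding eq mult.assoc by (intro mult_left_mono) auto
  have "x \<le> pi * 2 ^ (m + 1) * (1 - s) powr (- (real m + 1 / 2))"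
    using slope_integral_upper[OF assms, of m] x by (simp del: power_Suc)
  then show "gaussian_moment m s \<le> fact m * 2 ^ m * (pi * 2 ^ (m + 1)) * (1 - s) powr (- (real m + 1 / 2))"
    unfolding eq mult.assoc by (intro mult_left_mono) auto
qed

lemma psi_eq_gaussian_moment:
  "psi (m + 2) \<alpha> = 1 / (2 ^ m * (Gamma (real (m + 2) / 2))\<^sup>2) *
     (LINT t:{0..1}|lborel. (1 - t\<^sup>2) powr (real m / 2) * gaussian_moment m (t * \<alpha>))"
  by (simp add: psi_def gaussian_moment_def mult.assoc)

text \<open>
  A model for the \<open>t\<close>-integrand of \<open>\<psi>\<^bsub>m+2\<^esub>\<close> at \<open>\<alpha> = 1 - \<epsilon>\<close> in which \<open>t\<close> enters only through its distance
  to the edge \<open>t = 1\<close>, so that antiderivatives are elementary.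
\<close>

definition edge_kernel :: "nat \<Rightarrow> real \<Rightarrow> real \<Rightarrow> real" where
  "edge_kernel m \<epsilon> t = (1 - t) powr (real m / 2) * (1 - t + \<epsilon>) powr (- (real m + 1 / 2))"

lemma continuous_on_edge_kernel:
  assumes "0 < m" "0 < \<epsilon>"
  shows "continuous_on {0..1} (edge_kernel m \<epsilon>)"
  unfolding edge_kernel_def using assms
  by (intro continuous_on_mult continuous_on_powr' continuous_intros) auto

lemma edge_kernel_nonneg: "0 \<le> edge_kernel m \<epsilon> t"
  by (simp add: edge_kernel_def)

lemma edge_kernel_integrable:
  assumes "0 < m" "0 < \<epsilon>" "0 \<le> a" "b \<le> 1"
  shows "edge_kernel m \<epsilon> integrable_on {a..b}"
  using assms by (intro integrable_continuous_interval continuous_on_subset[OF continuous_on_edge_kernel]) auto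

text \<open>
  Here \<open>1 - t \<le> 1 - t\<^sup>2 \<le> 2 (1 - t)\<close> and \<open>1 - t \<alpha> = (1 - t) + t (1 - \<alpha>)\<close>. The latter is clearly at most
  \<open>(1 - t) + (1 - \<alpha>)\<close>; it is at least half of it when \<open>t \<ge> 1/2\<close>, and when \<open>t \<le> 1/2\<close> it is at least \<open>1/2\<close>
  while \<open>(1 - t) + (1 - \<alpha>) \<le> 3\<close>. This is the origin of the constant \<open>6\<close>.
\<close>

lemma psi_integrand_bounds:
  assumes "-1 \<le> \<alpha>" "\<alpha> < 1" "0 \<le> t" "t \<le> 1"
  shows "(1 - t\<^sup>2) powr (real m / 2) * gaussian_moment m (t * \<alpha>)
       \<le> fact m * 2 ^ m * (pi * 2 ^ (m + 1)) * (2 powr (real m / 2) * 6 powr (real m + 1 / 2))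
           * edge_kernel m (1 - \<alpha>) t"
    and "fact m * 2 ^ m * (1 / 6) ^ (m + 1) * edge_kernel m (1 - \<alpha>) t
       \<le> (1 - t\<^sup>2) powr (real m / 2) * gaussian_moment m (t * \<alpha>)"
proof -
  let ?p = "- (real m + 1 / 2)"
  have s1: "t * \<alpha> < 1"
  proof (cases "\<alpha> \<le> 0")
    case True
    then have "t * \<alpha> \<le> 0" using assms by (simp add: mult_nonneg_nonpos)
    then show ?thesis by simp
  next
    case False
    then have "t * \<alpha> \<le> \<alpha>" using assms by (simp add: mult_left_le_one_le)
    then show ?thesis using assms by simp
  qed
  have "t * (-1) \<le> t * \<alpha>" using assms by (intro mult_left_mono) auto
  then have s0: "-1 \<le> t * \<alpha>" using assms by simp
  have t2: "1 - t\<^sup>2 = (1 - t) * (1 + t)" by (simp add: power2_eq_square algebra_simps)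
  have w1: "1 - t \<le> 1 - t\<^sup>2" using assms by (simp add: power2_eq_square mult_left_le)
  have w2: "1 - t\<^sup>2 \<le> 2 * (1 - t)"
    unfolding t2 using mult_left_mono[of "1 + t" 2 "1 - t"] assms by simp
  have split: "1 - t * \<alpha> = (1 - t) + t * (1 - \<alpha>)" by (simp add: algebra_simps)
  have v1: "1 - t * \<alpha> \<le> 1 - t + (1 - \<alpha>)"
    unfolding split using assms mult_right_mono[of t 1 "1 - \<alpha>"] by simp
  have v2: "(1 - t + (1 - \<alpha>)) / 6 \<le> 1 - t * \<alpha>"
  proof (cases "t \<le> 1 / 2")
    case True
    have "0 \<le> t * (1 - \<alpha>)" using assms by simp
    then show ?thesis unfolding split using True assms by argo
  next
    case False
    then have "1 / 2 * (1 - \<alpha>) \<le> t * (1 - \<alpha>)" using assms by (intro mult_right_mono) auto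
    then show ?thesis unfolding split using assms by (simp add: field_simps)
  qed
  have "(1 - t\<^sup>2) powr (real m / 2) \<le> (2 * (1 - t)) powr (real m / 2)"
    using w1 w2 assms by (intro powr_mono2) auto
  also have "\<dots> = 2 powr (real m / 2) * (1 - t) powr (real m / 2)"
    using assms by (intro powr_mult)
  finally have W: "(1 - t\<^sup>2) powr (real m / 2) \<le> 2 powr (real m / 2) * (1 - t) powr (real m / 2)" .
  have "(1 - t * \<alpha>) powr ?p \<le> ((1 - t + (1 - \<alpha>)) / 6) powr ?p"
    using v2 assms by (intro powr_mono2') auto
  also have "\<dots> = 6 powr (real m + 1 / 2) * (1 - t + (1 - \<alpha>)) powr ?p"
    using assms by (simp add: powr_divide powr_minus field_simps)
  finally have V: "(1 - t * \<alpha>) powr ?p \<le> 6 powr (real m + 1 / 2) * (1 - t + (1 - \<alpha>)) powr ?p" .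
  have "(1 - t\<^sup>2) powr (real m / 2) * gaussian_moment m (t * \<alpha>)
      \<le> (1 - t\<^sup>2) powr (real m / 2) * (fact m * 2 ^ m * (pi * 2 ^ (m + 1)) * (1 - t * \<alpha>) powr ?p)"
    by (intro mult_left_mono gaussian_moment_bounds s0 s1) auto
  also have "\<dots> \<le> (2 powr (real m / 2) * (1 - t) powr (real m / 2)) *
      (fact m * 2 ^ m * (pi * 2 ^ (m + 1)) * (6 powr (real m + 1 / 2) * (1 - t + (1 - \<alpha>)) powr ?p))"
    by (intro mult_mono mult_left_mono W V) auto
  finally show "(1 - t\<^sup>2) powr (real m / 2) * gaussian_moment m (t * \<alpha>)
       \<le> fact m * 2 ^ m * (pi * 2 ^ (m + 1)) * (2 powr (real m / 2) * 6 powr (real m + 1 / 2))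
           * edge_kernel m (1 - \<alpha>) t"
    by (simp only: edge_kernel_def mult_ac)
  have "fact m * 2 ^ m * (1 / 6) ^ (m + 1) * edge_kernel m (1 - \<alpha>) t
      = (1 - t) powr (real m / 2) *
        (fact m * 2 ^ m * (1 / 6) ^ (m + 1) * (1 - t + (1 - \<alpha>)) powr ?p)"
    by (simp only: edge_kernel_def mult_ac)
  also have "\<dots> \<le> (1 - t\<^sup>2) powr (real m / 2) *
        (fact m * 2 ^ m * (1 / 6) ^ (m + 1) * (1 - t * \<alpha>) powr ?p)"
    using w1 v1 s1 assms by (intro mult_mono mult_left_mono powr_mono2 powr_mono2') auto
  also have "\<dots> \<le> (1 - t\<^sup>2) powr (real m / 2) * gaussian_moment m (t * \<alpha>)"
    by (intro mult_left_mono gaussian_moment_bounds s0 s1) auto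
  finally show "fact m * 2 ^ m * (1 / 6) ^ (m + 1) * edge_kernel m (1 - \<alpha>) t
       \<le> (1 - t\<^sup>2) powr (real m / 2) * gaussian_moment m (t * \<alpha>)" .
qed

section \<open>Size of the endpoint integral\<close>

text \<open>
  Keep only the \<open>t\<close> with \<open>\<epsilon>/4 \<le> 1 - t \<le> \<epsilon>/2\<close>. This range lies in \<open>[0,1]\<close> even for the largest value
  \<open>\<epsilon> = 2\<close>, and on it each factor of the kernel is a constant times a power of \<open>\<epsilon>\<close>.
\<close>

lemma edge_integral_lower:
  assumes "0 < m" "0 < \<epsilon>" "\<epsilon> \<le> 2"
  shows "(1 / 4) powr (real m / 2 + 1) * 2 powr (- (real m + 1 / 2)) * \<epsilon> powr (- ((real m - 1) / 2))
           \<le> integral {0..1} (edge_kernel m \<epsilon>)"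
proof -
  let ?c = "(\<epsilon> / 4) powr (real m / 2) * (2 * \<epsilon>) powr (- (real m + 1 / 2))"
  let ?I = "{1 - \<epsilon> / 2..1 - \<epsilon> / 4}"
  have "(1 / 4) powr (real m / 2 + 1) * 2 powr (- (real m + 1 / 2)) * \<epsilon> powr (- ((real m - 1) / 2))
      = (\<epsilon> / 4) * ?c"
  proof -
    have "- ((real m - 1) / 2) = 1 + real m / 2 + (- (real m + 1 / 2))" by (simp add: field_simps)
    then have "\<epsilon> powr (- ((real m - 1) / 2)) = \<epsilon> * \<epsilon> powr (real m / 2) * \<epsilon> powr (- (real m + 1 / 2))"
      using assms by (simp only: powr_add powr_one less_imp_le)
    moreover have "(1 / 4 :: real) powr (real m / 2 + 1) = (1 / 4) powr (real m / 2) / 4"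
      by (simp add: powr_add)
    moreover have "(\<epsilon> / 4) powr (real m / 2) = \<epsilon> powr (real m / 2) * (1 / 4) powr (real m / 2)"
      using assms powr_mult[of \<epsilon> "1 / 4" "real m / 2"] by simp
    moreover have "(2 * \<epsilon>) powr (- (real m + 1 / 2)) = 2 powr (- (real m + 1 / 2)) * \<epsilon> powr (- (real m + 1 / 2))"
      using assms by (simp only: powr_mult)
    ultimately show ?thesis by (simp only: mult_ac times_divide_eq_left times_divide_eq_right)
  qed
  also have "\<dots> = integral ?I (\<lambda>t. ?c)" using assms by simp
  also have "\<dots> \<le> integral ?I (edge_kernel m \<epsilon>)"
  proof (rule integral_le)
    fix t assume "t \<in> ?I"
    then show "?c \<le> edge_kernel m \<epsilon> t"
      unfolding edge_kernel_def using assms by (intro mult_mono powr_mono2 powr_mono2') auto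
  qed (use assms edge_kernel_integrable in auto)
  also have "\<dots> \<le> integral {0..1} (edge_kernel m \<epsilon>)"
    using assms by (intro integral_subset_le edge_kernel_integrable) (auto intro: edge_kernel_nonneg)
  finally show ?thesis .
qed

text \<open>
  Replacing \<open>1 - t\<close> by \<open>1 - t + \<epsilon>\<close> leaves a single power, which has an elementary antiderivative and,
  up to a constant, does not change the size of the integral.
\<close>

lemma edge_kernel_le:
  assumes "0 < \<epsilon>" "0 \<le> t" "t \<le> 1"
  shows "edge_kernel m \<epsilon> t \<le> (1 - t + \<epsilon>) powr (- ((real m + 1) / 2))"
proof -
  have "edge_kernel m \<epsilon> t \<le> (1 - t + \<epsilon>) powr (real m / 2) * (1 - t + \<epsilon>) powr (- (real m + 1 / 2))"
    unfolding edge_kernel_def using assms by (intro mult_right_mono powr_mono2) auto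
  also have "\<dots> = (1 - t + \<epsilon>) powr (real m / 2 + (- (real m + 1 / 2)))" by (simp only: powr_add)
  also have "real m / 2 + (- (real m + 1 / 2)) = - ((real m + 1) / 2)" by (simp add: field_simps)
  finally show ?thesis .
qed

lemma edge_integral_upper_power:
  assumes "2 \<le> m" "0 < \<epsilon>"
  shows "integral {0..1} (edge_kernel m \<epsilon>) \<le> 2 / (real m - 1) * \<epsilon> powr (- ((real m - 1) / 2))"
proof -
  define p where "p = (real m - 1) / 2"
  have p: "0 < p" "- p - 1 = - ((real m + 1) / 2)" using assms by (auto simp: p_def field_simps)
  let ?G = "\<lambda>t. 1 / p * (1 - t + \<epsilon>) powr (- p)"
  have FTC: "((\<lambda>t. (1 - t + \<epsilon>) powr (- ((real m + 1) / 2))) has_integral (?G 1 - ?G 0)) {0..1}"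
  proof (rule fundamental_theorem_of_calculus)
    fix t :: real assume t: "t \<in> {0..1}"
    have "(?G has_real_derivative (1 - t + \<epsilon>) powr (- p - 1)) (at t within {0..1})"
      using t assms(2) p(1) by (auto intro!: derivative_eq_intros)
    then show "(?G has_vector_derivative (1 - t + \<epsilon>) powr (- ((real m + 1) / 2))) (at t within {0..1})"
      by (simp only: p has_real_derivative_iff_has_vector_derivative)
  qed simp
  have "integral {0..1} (edge_kernel m \<epsilon>) \<le> ?G 1 - ?G 0"
    using assms edge_kernel_le
    by (intro has_integral_le[OF integrable_integral[OF edge_kernel_integrable] FTC]) auto
  also have "\<dots> \<le> ?G 1" using p by simp
  finally show ?thesis by (simp add: p_def)
qed

lemma edge_integral_upper_log:
  assumes "0 < \<epsilon>"
  shows "integral {0..1} (edge_kernel 1 \<epsilon>) \<le> ln (1 + \<epsilon>) + ln (1 / \<epsilon>)"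
proof -
  let ?G = "\<lambda>t. - ln (1 - t + \<epsilon>)"
  have FTC: "((\<lambda>t. 1 / (1 - t + \<epsilon>)) has_integral (?G 1 - ?G 0)) {0..1}"
    using assms
    by (intro fundamental_theorem_of_calculus)
       (auto intro!: derivative_eq_intros simp flip: has_real_derivative_iff_has_vector_derivative)
  have "integral {0..1} (edge_kernel 1 \<epsilon>) \<le> ?G 1 - ?G 0"
  proof (rule has_integral_le[OF integrable_integral FTC])
    fix t :: real assume "t \<in> {0..1}"
    then show "edge_kernel 1 \<epsilon> t \<le> 1 / (1 - t + \<epsilon>)"
      using assms edge_kernel_le[of \<epsilon> t 1] by (simp add: powr_minus inverse_eq_divide)
  qed (use assms edge_kernel_integrable in auto)
  then show ?thesis using assms by (simp add: ln_div)
qed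

text \<open>
  For \<open>1 - t \<ge> \<epsilon>\<close> one has \<open>1 - t + \<epsilon> \<le> 2 (1 - t)\<close>, so the kernel is at least a multiple of \<open>1 / (1 - t)\<close>;
  cutting at \<open>t = 1 - \<epsilon>\<close> produces the logarithm exactly, without an additive error that would spoil the
  comparison when \<open>ln (1 / \<epsilon>)\<close> is small.
\<close>

lemma edge_integral_lower_log:
  assumes "0 < \<epsilon>" "\<epsilon> \<le> 1"
  shows "2 powr (- (3 / 2)) * ln (1 / \<epsilon>) \<le> integral {0..1} (edge_kernel 1 \<epsilon>)"
proof -
  let ?c = "2 powr (- (3 / 2)) :: real"
  have "((\<lambda>t. ?c * (1 / (1 - t))) has_integral (?c * (- ln (1 - (1 - \<epsilon>))) - ?c * (- ln (1 - 0)))) {0..1 - \<epsilon>}"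
    using assms
    by (intro fundamental_theorem_of_calculus)
       (auto intro!: derivative_eq_intros simp flip: has_real_derivative_iff_has_vector_derivative)
  then have FTC: "((\<lambda>t. ?c * (1 / (1 - t))) has_integral (?c * ln (1 / \<epsilon>))) {0..1 - \<epsilon>}"
    using assms by (simp add: ln_div)
  have "?c * ln (1 / \<epsilon>) \<le> integral {0..1 - \<epsilon>} (edge_kernel 1 \<epsilon>)"
  proof (rule has_integral_le[OF FTC integrable_integral])
    fix t :: real assume "t \<in> {0..1 - \<epsilon>}"
    then have t: "\<epsilon> \<le> 1 - t" "0 < 1 - t" using assms by auto
    have "(1 - t) powr (1 / 2) * (1 - t) powr (- (3 / 2)) = (1 - t) powr (-1)"
      by (simp flip: powr_add)
    moreover have "(2 * (1 - t)) powr (- (3 / 2)) = ?c * (1 - t) powr (- (3 / 2))"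
      using t by (simp only: powr_mult less_imp_le)
    moreover have "1 / (1 - t) = (1 - t) powr (-1)"
      using t by (simp add: powr_minus inverse_eq_divide)
    ultimately have "?c * (1 / (1 - t)) = (1 - t) powr (1 / 2) * (2 * (1 - t)) powr (- (3 / 2))"
      by (metis mult.left_commute)
    also have "\<dots> \<le> edge_kernel 1 \<epsilon> t"
      unfolding edge_kernel_def using t assms by (auto intro!: mult_left_mono powr_mono2')
    finally show "?c * (1 / (1 - t)) \<le> edge_kernel 1 \<epsilon> t" .
  qed (use assms edge_kernel_integrable in auto)
  also have "\<dots> \<le> integral {0..1} (edge_kernel 1 \<epsilon>)"
    using assms by (intro integral_subset_le edge_kernel_integrable) (auto intro: edge_kernel_nonneg)
  finally show ?thesis .
qed

section \<open>Comparability\<close>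

lemma comparable_onI:
  assumes "0 < c" "0 < C"
    and "\<And>x. x \<in> A \<Longrightarrow> 0 < Q2 x"
    and "\<And>x. x \<in> A \<Longrightarrow> c * Q2 x \<le> Q1 x" "\<And>x. x \<in> A \<Longrightarrow> Q1 x \<le> C * Q2 x"
  shows "comparable_on A Q1 Q2"
proof -
  have "0 < Q1 x" if "x \<in> A" for x
    using assms(3,4)[OF that] mult_pos_pos[OF assms(1)] by force
  moreover have "c \<le> Q1 x / Q2 x \<and> Q1 x / Q2 x \<le> C" if "x \<in> A" for x
    using assms(3-5)[OF that] by (simp add: pos_le_divide_eq pos_divide_le_eq)
  ultimately show ?thesis unfolding comparable_on_def using assms(1-3) by blast
qed

lemma comparable_on_trans:
  assumes "comparable_on A Q1 Q2" "comparable_on B Q2 Q3" "B \<subseteq> A"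
  shows "comparable_on B Q1 Q3"
proof -
  obtain c C where 1: "0 < c" "0 < C" "\<And>x. x \<in> A \<Longrightarrow> c \<le> Q1 x / Q2 x \<and> Q1 x / Q2 x \<le> C"
    using assms(1) unfolding comparable_on_def by blast
  obtain d D where 2: "0 < d" "0 < D" "\<And>x. x \<in> B \<Longrightarrow> d \<le> Q2 x / Q3 x \<and> Q2 x / Q3 x \<le> D"
    using assms(2) unfolding comparable_on_def by blast
  have pos: "0 < Q1 x \<and> 0 < Q2 x \<and> 0 < Q3 x" if "x \<in> B" for x
    using that assms unfolding comparable_on_def by blast
  have "c * d \<le> Q1 x / Q3 x \<and> Q1 x / Q3 x \<le> C * D" if x: "x \<in> B" for x
  proof -
    have "Q1 x / Q3 x = (Q1 x / Q2 x) * (Q2 x / Q3 x)" using pos[OF x] by simp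
    moreover have "c * d \<le> (Q1 x / Q2 x) * (Q2 x / Q3 x)"
      using 1 2(1,3) x assms(3) pos[OF x] by (intro mult_mono) auto
    moreover have "(Q1 x / Q2 x) * (Q2 x / Q3 x) \<le> C * D"
      using 1 2(2,3) x assms(3) pos[OF x] by (intro mult_mono) auto
    ultimately show ?thesis by (simp only: conj_ac)
  qed
  moreover have "0 < c * d" "0 < C * D" using 1 2 by simp_all
  ultimately show ?thesis unfolding comparable_on_def using pos by blast
qed

lemma edge_integral_pos:
  assumes "0 < m" "0 < \<epsilon>" "\<epsilon> \<le> 2"
  shows "0 < integral {0..1} (edge_kernel m \<epsilon>)"
  by (rule less_le_trans[OF _ edge_integral_lower[OF assms]]) (use assms in auto)

text \<open>
  The two-sided bound on the integrand is also what makes it integrable in \<open>t\<close>, by domination with the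
  continuous kernel.
\<close>

lemma psi_comparable_edge_integral:
  assumes "0 < m"
  shows "comparable_on {-1..<1} (psi (m + 2)) (\<lambda>\<alpha>. integral {0..1} (edge_kernel m (1 - \<alpha>)))"
proof -
  define N where "N = 1 / (2 ^ m * (Gamma (real (m + 2) / 2))\<^sup>2)"
  define c where "c = fact m * 2 ^ m * (1 / 6 :: real) ^ (m + 1)"
  define C where "C = fact m * 2 ^ m * (pi * 2 ^ (m + 1)) * (2 powr (real m / 2) * 6 powr (real m + 1 / 2))"
  have N: "0 < N" unfolding N_def
    by (intro divide_pos_pos mult_pos_pos zero_less_power Gamma_real_pos) auto
  have c: "0 < c" by (simp add: c_def)
  have C: "0 < C" by (simp add: C_def)
  have bounds: "c * integral {0..1} (edge_kernel m (1 - \<alpha>))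
        \<le> (LINT t:{0..1}|lborel. (1 - t\<^sup>2) powr (real m / 2) * gaussian_moment m (t * \<alpha>))"
      "(LINT t:{0..1}|lborel. (1 - t\<^sup>2) powr (real m / 2) * gaussian_moment m (t * \<alpha>))
        \<le> C * integral {0..1} (edge_kernel m (1 - \<alpha>))"
    if \<alpha>: "\<alpha> \<in> {-1..<1}" for \<alpha>
  proof -
    let ?g = "\<lambda>t. (1 - t\<^sup>2) powr (real m / 2) * gaussian_moment m (t * \<alpha>)"
    let ?k = "edge_kernel m (1 - \<alpha>)"
    have k: "set_integrable lborel {0..1} ?k"
      using assms \<alpha> by (intro borel_integrable_atLeastAtMost' continuous_on_edge_kernel) auto
    have le: "c * ?k t \<le> ?g t" "?g t \<le> C * ?k t" if "t \<in> {0..1}" for t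
      unfolding c_def C_def using that \<alpha>
        psi_integrand_bounds[of \<alpha> t m] by (simp_all del: power_Suc power_Suc2)
    have g0: "0 \<le> ?g t" if "t \<in> {0..1}" for t
      using le(1)[OF that] c edge_kernel_nonneg[of m "1 - \<alpha>" t]
      by (meson mult_nonneg_nonneg less_imp_le order_trans)
    have g: "set_integrable lborel {0..1} ?g"
    proof (rule set_integrable_bound)
      show "set_integrable lborel {0..1} (\<lambda>t. C * ?k t)" using k by simp
      show "set_borel_measurable lborel {0..1} ?g"
        unfolding set_borel_measurable_def by measurable
      show "AE t in lborel. t \<in> {0..1} \<longrightarrow> norm (?g t) \<le> norm (C * ?k t)"
        using le(2) g0 by (intro AE_I2) force
    qed
    have K: "(LINT t:{0..1}|lborel. ?k t) = integral {0..1} ?k"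
      by (rule set_borel_integral_eq_integral(2)[OF k])
    show "c * integral {0..1} ?k \<le> (LINT t:{0..1}|lborel. ?g t)"
      unfolding K[symmetric] set_integral_mult_right[symmetric]
      using k g le by (intro set_integral_mono) auto
    show "(LINT t:{0..1}|lborel. ?g t) \<le> C * integral {0..1} ?k"
      unfolding K[symmetric] set_integral_mult_right[symmetric]
      using k g le by (intro set_integral_mono) auto
  qed
  show ?thesis
  proof (rule comparable_onI[of "N * c" "N * C"])
    fix \<alpha> :: real assume \<alpha>: "\<alpha> \<in> {-1..<1}"
    show "0 < integral {0..1} (edge_kernel m (1 - \<alpha>))"
      using \<alpha> assms by (intro edge_integral_pos) auto
    show "N * c * integral {0..1} (edge_kernel m (1 - \<alpha>)) \<le> psi (m + 2) \<alpha>"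
         "psi (m + 2) \<alpha> \<le> N * C * integral {0..1} (edge_kernel m (1 - \<alpha>))"
      unfolding psi_eq_gaussian_moment N_def[symmetric] mult.assoc
      using bounds[OF \<alpha>] N by (auto intro!: mult_left_mono)
  qed (use N c C in auto)
qed

lemma edge_integral_comparable_power:
  assumes "2 \<le> m"
  shows "comparable_on {-1..<1} (\<lambda>\<alpha>. integral {0..1} (edge_kernel m (1 - \<alpha>)))
           (\<lambda>\<alpha>. (1 - \<alpha>) powr (- ((real m - 1) / 2)))"
proof (rule comparable_onI)
  fix \<alpha> :: real assume "\<alpha> \<in> {-1..<1}"
  then have \<alpha>: "0 < 1 - \<alpha>" "1 - \<alpha> \<le> 2" by auto
  show "(1 / 4) powr (real m / 2 + 1) * 2 powr (- (real m + 1 / 2)) * (1 - \<alpha>) powr (- ((real m - 1) / 2))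
               \<le> integral {0..1} (edge_kernel m (1 - \<alpha>))"
    and "integral {0..1} (edge_kernel m (1 - \<alpha>)) \<le> 2 / (real m - 1) * (1 - \<alpha>) powr (- ((real m - 1) / 2))"
    by (rule edge_integral_lower edge_integral_upper_power; use assms \<alpha> in linarith)+
qed (use assms in auto)

text \<open>
  The upper bound \<open>ln (1 + \<epsilon>) + ln (1 / \<epsilon>)\<close> does not vanish at \<open>\<epsilon> = 1\<close>, whereas \<open>ln (1 / \<epsilon>)\<close> does. Since
  \<open>ln (1 / \<epsilon>) \<ge> ln (1 / (1 - \<alpha>\<^sub>0)) > 0\<close>, the excess, at most \<open>ln 2\<close>, is absorbed into a constant that depends
  on \<open>\<alpha>\<^sub>0\<close>.
\<close>

lemma edge_integral_comparable_log:
  assumes "0 < \<alpha>\<^sub>0" "\<alpha>\<^sub>0 < 1"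
  shows "comparable_on {\<alpha>\<^sub>0..<1} (\<lambda>\<alpha>. integral {0..1} (edge_kernel 1 (1 - \<alpha>))) (\<lambda>\<alpha>. ln (1 / (1 - \<alpha>)))"
proof -
  let ?l = "ln (1 / (1 - \<alpha>\<^sub>0))"
  have l: "0 < ?l" using assms by simp
  show ?thesis
  proof (rule comparable_onI[of "2 powr (- (3 / 2))" "1 + ln 2 / ?l"])
    show "0 < 1 + ln 2 / ?l" using l by (intro add_pos_nonneg) auto
    fix \<alpha> assume \<alpha>: "\<alpha> \<in> {\<alpha>\<^sub>0..<1}"
    show "0 < ln (1 / (1 - \<alpha>))" using \<alpha> assms by auto
    show "2 powr (- (3 / 2)) * ln (1 / (1 - \<alpha>)) \<le> integral {0..1} (edge_kernel 1 (1 - \<alpha>))"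
      using \<alpha> assms by (intro edge_integral_lower_log) auto
    have "?l \<le> ln (1 / (1 - \<alpha>))"
      using \<alpha> assms by (intro ln_mono divide_left_mono) auto
    then have "ln 2 / ?l * ?l \<le> ln 2 / ?l * ln (1 / (1 - \<alpha>))"
      using l by (intro mult_left_mono) auto
    then have "ln 2 \<le> ln 2 / ?l * ln (1 / (1 - \<alpha>))" using l by simp
    moreover have "ln (1 + (1 - \<alpha>)) \<le> ln 2" using \<alpha> assms by (intro ln_mono) auto
    moreover have "integral {0..1} (edge_kernel 1 (1 - \<alpha>)) \<le> ln (1 + (1 - \<alpha>)) + ln (1 / (1 - \<alpha>))"
      using \<alpha> by (intro edge_integral_upper_log) auto
    ultimately show "integral {0..1} (edge_kernel 1 (1 - \<alpha>)) \<le> (1 + ln 2 / ?l) * ln (1 / (1 - \<alpha>))"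
      unfolding distrib_right mult_1 by linarith
  qed simp
qed

text \<open>
  In the case \<open>m = 1\<close> the power of \<open>\<epsilon>\<close> in the lower bound has exponent \<open>0\<close>, so that bound is a positive
  constant valid up to \<open>\<epsilon> = 2\<close>, that is, down to \<open>\<alpha> = -1\<close>.
\<close>

lemma edge_integral_comparable_const:
  assumes "0 < \<alpha>\<^sub>0" "\<alpha>\<^sub>0 < 1"
  shows "comparable_on {-1..\<alpha>\<^sub>0} (\<lambda>\<alpha>. integral {0..1} (edge_kernel 1 (1 - \<alpha>))) (\<lambda>\<alpha>. 1)"
proof (rule comparable_onI[of "(1 / 4) powr (3 / 2) * 2 powr (- (3 / 2))" "ln 3 + ln (1 / (1 - \<alpha>\<^sub>0))"])
  show "0 < ln 3 + ln (1 / (1 - \<alpha>\<^sub>0))" using assms by (intro add_pos_pos) auto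
  fix \<alpha> assume \<alpha>: "\<alpha> \<in> {-1..\<alpha>\<^sub>0}"
  show "(1 / 4) powr (3 / 2) * 2 powr (- (3 / 2)) * 1 \<le> integral {0..1} (edge_kernel 1 (1 - \<alpha>))"
    using edge_integral_lower[of 1 "1 - \<alpha>"] \<alpha> assms by simp
  have "ln (1 + (1 - \<alpha>)) \<le> ln 3" "ln (1 / (1 - \<alpha>)) \<le> ln (1 / (1 - \<alpha>\<^sub>0))"
    using \<alpha> assms by (intro ln_mono divide_left_mono; force)+
  moreover have "integral {0..1} (edge_kernel 1 (1 - \<alpha>)) \<le> ln (1 + (1 - \<alpha>)) + ln (1 / (1 - \<alpha>))"
    using \<alpha> assms by (intro edge_integral_upper_log) auto
  ultimately show "integral {0..1} (edge_kernel 1 (1 - \<alpha>)) \<le> (ln 3 + ln (1 / (1 - \<alpha>\<^sub>0))) * 1"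
    unfolding mult_1_right by linarith
qed auto

theorem proposition5p3:
  fixes n :: nat
  assumes "n \<ge> 3"
  shows "(n \<ge> 4 \<longrightarrow>
            comparable_on {-1..<1} (psi n) (\<lambda>\<alpha>. (1 - \<alpha>) powr (- ((real n - 3) / 2))))
       \<and> (n = 3 \<longrightarrow> (\<forall>\<alpha>\<^sub>0::real. 0 < \<alpha>\<^sub>0 \<and> \<alpha>\<^sub>0 < 1 \<longrightarrow>
            comparable_on {\<alpha>\<^sub>0..<1} (psi n) (\<lambda>\<alpha>. ln (1 / (1 - \<alpha>)))
          \<and> comparable_on {-1..\<alpha>\<^sub>0} (psi n) (\<lambda>\<alpha>. 1)))"
proof -
  define m where "m = n - 2"
  have n: "n = m + 2" "0 < m" using assms by (auto simp: m_def)
  note reduce = comparable_on_trans[OF psi_comparable_edge_integral[OF n(2)]]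
  have "comparable_on {-1..<1} (psi n) (\<lambda>\<alpha>. (1 - \<alpha>) powr (- ((real n - 3) / 2)))" if "n \<ge> 4"
  proof -
    have "real n - 3 = real m - 1" using n by simp
    then show ?thesis
      using reduce[OF edge_integral_comparable_power] that n by simp
  qed
  moreover have "comparable_on {\<alpha>\<^sub>0..<1} (psi n) (\<lambda>\<alpha>. ln (1 / (1 - \<alpha>)))
               \<and> comparable_on {-1..\<alpha>\<^sub>0} (psi n) (\<lambda>\<alpha>. 1)"
    if "n = 3" "0 < \<alpha>\<^sub>0" "\<alpha>\<^sub>0 < 1" for \<alpha>\<^sub>0
  proof -
    have m: "m = 1" using that n by simp
    show ?thesis
      unfolding n(1) m using that
      by (intro conjI reduce[unfolded m] edge_integral_comparable_log edge_integral_comparable_const) auto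
  qed
  ultimately show ?thesis by blast
qed

end
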